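(* Let $(\Omega,F)$ and $(\Omega^*,F^* )$ be measurable spaces, let $\eta$ and $\tau$ be probability measures on $(\Omega,F)$, and let $f:\Omega\to\Omega^*$ be a measurable mapping. Let $\eta^*$ and $\tau^*$ be the image measures of $\eta$ and $\tau$ under $f$. If $\eta^*\perp\tau^*$, then $\eta\perp\tau$.
   Context: The image measures on $(\Omega^*,F^* )$ are defined by $\eta^*(E)=\eta(f^{-1}(E))$ and $\tau^*(E)=\tau(f^{-1}(E))$ for $E\in F^*$, where $f^{-1}(E)=\{\omega\in\Omega: f(\omega)\in E\}$. The notation $\eta\perp\tau$ means that $\eta$ and $\tau$ are mutually singular. *)

theory Defs
  imports "HOL-Probability.Probability"
begin

text \<open>Mutual singularity of two measures on a common measurable space. The first conjunct is needed
  because \<open>emeasure\<close> of a non-measurable set is \<open>0\<close>: without it, the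
  two null-set conditions could hold vacuously.\<close>

definition mutually_singular :: "'a measure \<Rightarrow> 'a measure \<Rightarrow> bool" where
  "mutually_singular M N \<longleftrightarrow>
     sets M = sets N \<and>
     (\<exists>A\<in>sets M. emeasure M A = 0 \<and> emeasure N (space N - A) = 0)"

end

theory Submission
  imports Defs
begin

text \<open>Singularity pulls back along \<open>f\<close>: if \<open>A\<close> separates the image
  measures, its preimage separates \<open>\<eta>\<close> and \<open>\<tau>\<close>. By
  \<open>emeasure_distr\<close>, an image measure gives \<open>A\<close> the mass of that preimage,
  and preimages commute with complements, so both null conditions transfer.\<close>

theorem theorem4:
  fixes \<Omega> :: "'a measure" and \<Omega>' :: "'b measure"
    and \<eta> \<tau> :: "'a measure" and f :: "'a \<Rightarrow> 'b"
  assumes "prob_space \<eta>" and "sets \<eta> = sets \<Omega>"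
    and "prob_space \<tau>" and "sets \<tau> = sets \<Omega>"
    and "f \<in> measurable \<Omega> \<Omega>'"
    and "mutually_singular (distr \<eta> \<Omega>' f) (distr \<tau> \<Omega>' f)"
  shows "mutually_singular \<eta> \<tau>"
proof -
  have f_eta: "f \<in> measurable \<eta> \<Omega>'" and f_tau: "f \<in> measurable \<tau> \<Omega>'"
    using assms(2,4,5) by (simp_all cong: measurable_cong_sets)
  have space_eq: "space \<eta> = space \<tau>"
    using assms(2,4) by (metis sets_eq_imp_space_eq)
  obtain A where A: "A \<in> sets \<Omega>'" "emeasure (distr \<eta> \<Omega>' f) A = 0"
      "emeasure (distr \<tau> \<Omega>' f) (space \<Omega>' - A) = 0"
    using assms(6) by (auto simp: mutually_singular_def)
  \<comment> \<open>\<open>f\<close> is total on the type, so its preimage is cut down to the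
    underlying space.\<close>
  define B where "B = f -` A \<inter> space \<eta>"
  have "B \<in> sets \<eta>"
    unfolding B_def using f_eta A(1) by (rule measurable_sets)
  moreover have "emeasure \<eta> B = 0"
    using A(1,2) f_eta by (simp add: B_def emeasure_distr)
  \<comment> \<open>The inclusion from left to right needs \<open>f\<close> to map
    \<open>space \<tau>\<close> into \<open>space \<Omega>'\<close>; \<open>space_eq\<close> is
    needed because \<open>B\<close> was cut with \<open>space \<eta>\<close>.\<close>
  moreover have "space \<tau> - B = f -` (space \<Omega>' - A) \<inter> space \<tau>"
    using measurable_space[OF f_tau] by (auto simp: B_def space_eq)
  then have "emeasure \<tau> (space \<tau> - B) = 0"
    using A(1,3) f_tau by (simp add: emeasure_distr sets.compl_sets)
  ultimately show ?thesis
    using assms(2,4) by (auto simp: mutually_singular_def)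
qed

end
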